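(* For every finite graph $G$, $\operatorname{bx}(G) \leq 6\operatorname{ltw}(G) + 4$.
   Context: A box in $\mathbb{R}^d$ is a Cartesian product of $d$ intervals of $\mathbb{R}$; the boxicity $\operatorname{bx}(G)$ is the minimum $d$ such that $G$ is the intersection graph of boxes in $\mathbb{R}^d$ (boxes $B_v$, $v\in V(G)$, with $B_v\cap B_w\ne\emptyset$ iff $vw\in E(G)$ for distinct $v,w$). A tree decomposition of $G$ is a family $(B_x : x\in V(T))$ of nonempty subsets of $V(G)$ indexed by the nodes of a tree $T$ such that for each $v\in V(G)$ the set $\{x: v\in B_x\}$ induces a nonempty connected subtree of $T$, and each edge $vw$ has both ends in some $B_x$. A layering of $G$ is a partition $(V_1,\dots,V_n)$ of $V(G)$ such that for every edge $vw$ there is $i\in[n-1]$ with $v,w\in V_i\cup V_{i+1}$. The layered treewidth $\operatorname{ltw}(G)$ is the minimum integer $k$ such that there exist a tree decomposition $(B_x:x\in V(T))$ and a layering $(V_1,\dots,V_n)$ of $G$ with $|B_x\cap V_i|\le k$ for every node $x$ and every $i$. *)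

theory Defs
  imports "HOL-Analysis.Analysis" "Graph_Theory.Graph_Theory"
begin

text \<open>
  A finite simple graph is a \<^locale>\<open>pair_graph\<close>: finite, loop-free, with a symmetric arc relation,
  so that the edge \<open>vw\<close> is the pair of arcs \<open>(v, w)\<close> and \<open>(w, v)\<close>.

  In a symmetric digraph the library's cycles include the closed walks \<open>u, v, u\<close>, hence the library's
  predicate \<^const>\<open>tree\<close> fails for every symmetric digraph with an arc. Excluding only the cycles of
  length at least three gives undirected trees.
\<close>

definition undirected_tree :: "'a pair_pre_digraph \<Rightarrow> bool" where
  "undirected_tree T \<longleftrightarrow>
     pair_graph T \<and> Digraph_Component.connected (with_proj T) \<and>
     \<not> (\<exists>p. pre_digraph.cycle (with_proj T) p \<and> 3 \<le> length p)"

text \<open>Points of d-dimensional real space are extensional functions on \<open>{..<d}\<close>.\<close>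

definition is_box :: "nat \<Rightarrow> (nat \<Rightarrow> real) set \<Rightarrow> bool" where
  "is_box d S \<longleftrightarrow>
     (\<exists>I. (\<forall>i<d. is_interval (I i) \<and> I i \<noteq> {}) \<and> S = (\<Pi>\<^sub>E i\<in>{..<d}. I i))"

definition box_representation ::
  "'a pair_pre_digraph \<Rightarrow> nat \<Rightarrow> ('a \<Rightarrow> (nat \<Rightarrow> real) set) \<Rightarrow> bool" where
  "box_representation G d S \<longleftrightarrow>
     (\<forall>v\<in>pverts G. is_box d (S v)) \<and>
     (\<forall>v\<in>pverts G. \<forall>w\<in>pverts G. v \<noteq> w \<longrightarrow>
        (S v \<inter> S w \<noteq> {} \<longleftrightarrow> (v, w) \<in> parcs G))"

text \<open>Minima are taken in \<^typ>\<open>enat\<close>; the minimum over the empty set is infinite.\<close>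

definition boxicity :: "'a pair_pre_digraph \<Rightarrow> enat" where
  "boxicity G = (INF d\<in>{d. \<exists>S. box_representation G d S}. enat d)"

text \<open>
  \<^const>\<open>Digraph_Component.connected\<close> includes having at least one vertex.
\<close>

definition tree_decomposition ::
  "'a pair_pre_digraph \<Rightarrow> 'b pair_pre_digraph \<Rightarrow> ('b \<Rightarrow> 'a set) \<Rightarrow> bool" where
  "tree_decomposition G T B \<longleftrightarrow>
     undirected_tree T \<and>
     (\<forall>x\<in>pverts T. B x \<noteq> {} \<and> B x \<subseteq> pverts G) \<and>
     (\<forall>v\<in>pverts G. Digraph_Component.connected (with_proj T \<restriction> {x\<in>pverts T. v \<in> B x})) \<and>
     (\<forall>(v, w)\<in>parcs G. \<exists>x\<in>pverts T. v \<in> B x \<and> w \<in> B x)"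

text \<open>Layers \<open>L 1, \<dots>, L n\<close>; some of them may be empty.\<close>

definition layering :: "'a pair_pre_digraph \<Rightarrow> nat \<Rightarrow> (nat \<Rightarrow> 'a set) \<Rightarrow> bool" where
  "layering G n L \<longleftrightarrow>
     (\<Union>i\<in>{1..n}. L i) = pverts G \<and> disjoint_family_on L {1..n} \<and>
     (\<forall>(v, w)\<in>parcs G. \<exists>i\<in>{1..n - 1}. v \<in> L i \<union> L (i + 1) \<and> w \<in> L i \<union> L (i + 1))"

text \<open>Trees are finite, so taking their nodes in \<^typ>\<open>nat\<close> loses nothing.\<close>

definition layered_width_at_most :: "'a pair_pre_digraph \<Rightarrow> nat \<Rightarrow> bool" where
  "layered_width_at_most G k \<longleftrightarrow>
     (\<exists>(T :: nat pair_pre_digraph) B n L.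
        tree_decomposition G T B \<and> layering G n L \<and>
        (\<forall>x\<in>pverts T. \<forall>i\<in>{1..n}. card (B x \<inter> L i) \<le> k))"

definition layered_treewidth :: "'a pair_pre_digraph \<Rightarrow> enat" where
  "layered_treewidth G = (INF k\<in>{k. layered_width_at_most G k}. enat k)"

end

theory Submission
  imports Defs
begin

text \<open>
  The boxicity is even at most \<open>3k + 2\<close>, where \<open>k\<close> is the layered treewidth. Root the tree and
  number its nodes in depth-first order, so that the descendants of a node are numbered
  consecutively, and order the vertices by the topmost nodes of their subtrees. If \<open>w\<close> is a
  neighbour of \<open>v\<close>, and the topmost node of \<open>u\<close> lies on the tree path from that of \<open>w\<close> down to that
  of \<open>v\<close>, then \<open>w\<close> is in the bag at the topmost node of \<open>u\<close>. Only \<open>k\<close> vertices of this bag belong to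
  the layer of \<open>u\<close>. Greedy colouring therefore yields \<open>k\<close> colours, or \<open>3k\<close> when paired with the
  layer index modulo 3, such that \<open>w\<close> and \<open>u\<close> get different colours whenever their layers are at
  distance at most 2.

  One dimension separates vertices whose topmost nodes are incomparable in the ancestor order, a
  second one vertices in layers at distance at least 2. Each colour contributes one further
  dimension, and together they separate the remaining non-adjacent pairs.
\<close>

section \<open>Connected sets of nodes\<close>

definition connected_in :: "'a rel \<Rightarrow> 'a set \<Rightarrow> bool" where
  "connected_in E S \<longleftrightarrow> S \<noteq> {} \<and> (\<forall>x\<in>S. \<forall>y\<in>S. (x, y) \<in> rtrancl_on S E)"

lemma rtrancl_on_Int_Times: "rtrancl_on S (E \<inter> S \<times> S) = rtrancl_on S E"
proof (intro subset_antisym subrelI)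
  fix x y
  show "(x, y) \<in> rtrancl_on S E" if "(x, y) \<in> rtrancl_on S (E \<inter> S \<times> S)"
    using that by (rule rtrancl_on_mono[rotated 2]) auto
  show "(x, y) \<in> rtrancl_on S (E \<inter> S \<times> S)" if "(x, y) \<in> rtrancl_on S E"
    using that by (induction rule: rtrancl_on_induct) (auto intro: rtrancl_on_into_rtrancl_on)
qed

lemma connected_induce_subgraph_iff:
  assumes "sym (parcs T)"
  shows "Digraph_Component.connected (with_proj T \<restriction> S) \<longleftrightarrow> connected_in (parcs T) S"
proof -
  have "(arcs_ends (with_proj T \<restriction> S))\<^sup>s = parcs T \<inter> S \<times> S"
    using assms by (auto simp: symcl_def arcs_ends_conv dest: symD)
  then show ?thesis
    by (simp add: connected_conv connected_in_def rtrancl_on_Int_Times)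
qed

lemma connected_in_insert:
  assumes "connected_in E S" "p \<in> S" "(p, l) \<in> E" "sym E"
  shows "connected_in E (insert l S)"
proof -
  let ?R = "rtrancl_on (insert l S) E"
  have from_p: "(p, x) \<in> ?R" if "x \<in> insert l S" for x
  proof (cases "x \<in> S")
    case True
    then have "(p, x) \<in> rtrancl_on S E" using assms by (simp add: connected_in_def)
    then show ?thesis by (rule rtrancl_on_mono[rotated 2]) auto
  next
    case False
    then show ?thesis using that assms by (auto intro: rtrancl_on_into_rtrancl_on)
  qed
  then have "(x, p) \<in> ?R" if "x \<in> insert l S" for x
    using that rtrancl_on_sym[OF assms(4)] by (blast dest: symD)
  then show ?thesis using from_p unfolding connected_in_def by (blast intro: rtrancl_on_trans)
qed

lemma connected_in_leaving_edge:
  assumes "connected_in E V" "S \<subset> V" "S \<noteq> {}"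
  obtains p l where "p \<in> S" "l \<in> V - S" "(p, l) \<in> E"
proof -
  obtain s v where s: "s \<in> S" and v: "v \<in> V" "v \<notin> S" using assms by auto
  then have "(s, v) \<in> rtrancl_on V E" using assms by (auto simp: connected_in_def)
  then have "v \<in> S \<or> (\<exists>p\<in>S. \<exists>l\<in>V - S. (p, l) \<in> E)"
    by (induction rule: rtrancl_on_induct) (use s in auto)
  then show thesis using v that by blast
qed

lemma connected_in_induct [consumes 3, case_names singleton insert]:
  assumes "finite V" "sym E" "connected_in E V"
    and singleton: "\<And>r. r \<in> V \<Longrightarrow> P {r}"
    and insert: "\<And>S p l. \<lbrakk>S \<subseteq> V; connected_in E S; p \<in> S; l \<in> V - S; (p, l) \<in> E; P S\<rbrakk>
      \<Longrightarrow> P (insert l S)"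
  shows "P V"
proof -
  define \<A> where "\<A> = {S \<in> Pow V. connected_in E S \<and> P S}"
  obtain r where "r \<in> V" using assms(3) by (auto simp: connected_in_def)
  then have "{r} \<in> \<A>" using singleton by (simp add: \<A>_def connected_in_def)
  moreover have "finite \<A>" using assms(1) by (simp add: \<A>_def)
  ultimately obtain S where S: "S \<in> \<A>" and maximal: "\<forall>S'\<in>\<A>. S \<subseteq> S' \<longrightarrow> S = S'"
    using finite_has_maximal[of \<A>] by blast
  have "S = V"
  proof (rule ccontr)
    assume "S \<noteq> V"
    then obtain p l where leaf: "p \<in> S" "l \<in> V - S" "(p, l) \<in> E"
      using S connected_in_leaving_edge[OF assms(3), of S] by (auto simp: \<A>_def connected_in_def)
    then have "insert l S \<in> \<A>"
      using S insert[of S p l] connected_in_insert[of E S p l] assms(2) by (auto simp: \<A>_def)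
    then show False using maximal leaf by auto
  qed
  then show ?thesis using S by (simp add: \<A>_def)
qed

lemma undirected_tree_sym: "undirected_tree T \<Longrightarrow> sym (parcs T)"
  using pair_sym_digraph.pair_sym_arcs[of T]
  by (auto simp: undirected_tree_def pair_graph_def pair_pseudo_graph_def symmetric_def)

lemma undirected_tree_connected_in:
  assumes "undirected_tree T"
  shows "connected_in (parcs T) (pverts T)"
proof -
  interpret pair_graph T using assms by (simp add: undirected_tree_def)
  have "with_proj T \<restriction> pverts T = with_proj T"
    by (auto simp: induce_subgraph_def with_proj_def intro: in_arcsD1 in_arcsD2)
  then show ?thesis
    using connected_induce_subgraph_iff[OF undirected_tree_sym[OF assms], of "pverts T"] assms
    by (simp add: undirected_tree_def)
qed

lemma undirected_tree_unique_neighbour: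
  assumes T: "undirected_tree T" and S: "connected_in (parcs T) S" "S \<subseteq> pverts T"
    and l_notin: "l \<notin> S" and p_nb: "p \<in> S" "(p, l) \<in> parcs T" and q_nb: "q \<in> S" "(q, l) \<in> parcs T"
  shows "p = q"
proof (rule ccontr)
  assume "p \<noteq> q"
  interpret T: pair_graph T using T by (simp add: undirected_tree_def)
  define H where "H = \<lparr>pverts = S, parcs = parcs T \<inter> S \<times> S\<rparr>"
  interpret H: pair_wf_digraph H by unfold_locales (auto simp: H_def)
  have "p \<rightarrow>\<^sup>*\<^bsub>with_proj H\<^esub> q"
    using S p_nb q_nb by (simp add: reachable_def H_def rtrancl_on_Int_Times connected_in_def)
  then obtain w where "H.apath p w q" by (auto simp: H.reachable_apath)
  then have w: "T.awalk p w q" "distinct (pawalk_verts p w)" "set (pawalk_verts p w) \<subseteq> S"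
    using H.awalk_verts_in_verts[of p w] S(2) p_nb(1) unfolding H.apath_def H.awalk_def T.awalk_def
    by (auto simp: H_def)
  have "w \<noteq> []" using w \<open>p \<noteq> q\<close> by auto
  have lp_edge: "(l, p) \<in> parcs T" using p_nb undirected_tree_sym[OF T] by (auto dest: symD)
  let ?c = "(l, p) # w @ [(q, l)]"
  have walk: "T.awalk p (w @ [(q, l)]) l"
    using w(1) q_nb
    by (intro T.awalk_appendI[of p w q] T.arc_implies_awalk[of "(q, l)", simplified])
  then have "T.awalk l ?c l" using lp_edge by (simp add: T.awalk_Cons_iff del: T.awalk_append_iff)
  moreover have "distinct (tl (pawalk_verts l ?c))"
    using T.awalk_verts_append[OF walk] w l_notin by auto
  ultimately have "T.cycle ?c" by (auto simp: T.cycle_def)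
  moreover have "3 \<le> length ?c" using \<open>w \<noteq> []\<close> by (cases w) auto
  ultimately show False using T unfolding undirected_tree_def by blast
qed

section \<open>Depth-first numberings\<close>

definition ancestor :: "('b \<Rightarrow> nat) \<Rightarrow> ('b \<Rightarrow> nat) \<Rightarrow> 'b \<Rightarrow> 'b \<Rightarrow> bool" where
  "ancestor pre post z x \<longleftrightarrow> pre z \<le> pre x \<and> pre x \<le> post z"

text \<open>Of the two ends of an edge, the one with the smaller number is the parent.\<close>

definition dfs_numbering :: "'b rel \<Rightarrow> 'b set \<Rightarrow> ('b \<Rightarrow> nat) \<Rightarrow> ('b \<Rightarrow> nat) \<Rightarrow> bool" where
  "dfs_numbering E V pre post \<longleftrightarrow>
     inj_on pre V \<and> (\<forall>x\<in>V. pre x \<le> post x) \<and>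
     (\<forall>x\<in>V. \<forall>y\<in>V. (x, y) \<in> E \<and> pre x < pre y \<longrightarrow>
        (\<forall>z\<in>V. ancestor pre post z y \<longleftrightarrow> z = y \<or> ancestor pre post z x))"

text \<open>Doubling all numbers makes room for the new leaf directly after its parent.\<close>

lemma dfs_numbering_insert_leaf:
  assumes num: "dfs_numbering E V pre post" and l_notin: "l \<notin> V" and p_in: "p \<in> V"
    and parent: "\<And>x. x \<in> V \<Longrightarrow> (x, l) \<in> E \<or> (l, x) \<in> E \<Longrightarrow> x = p"
  shows "dfs_numbering E (insert l V)
           ((\<lambda>x. 2 * pre x)(l := 2 * pre p + 1)) ((\<lambda>x. 2 * post x + 1)(l := 2 * pre p + 1))"
    (is "dfs_numbering E _ ?pre ?post")
proof -
  have parity: "2 * a \<noteq> Suc (2 * b)" for a b :: nat by presburger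
  have "p \<noteq> l" using p_in l_notin by auto
  have ancestor_old: "ancestor ?pre ?post z x \<longleftrightarrow> ancestor pre post z x" if "z \<in> V" "x \<in> V" for z x
    using that l_notin by (auto simp: ancestor_def)
  have below_leaf: "\<not> ancestor ?pre ?post l x" if "x \<in> V" for x
    using that l_notin parity[of "pre x" "pre p"] by (auto simp: ancestor_def)
  have above_leaf: "ancestor ?pre ?post z l \<longleftrightarrow> ancestor pre post z p" if "z \<in> V" for z
    using that l_notin by (auto simp: ancestor_def)
  have "inj_on ?pre (insert l V)"
    using num parity parity[symmetric] by (auto simp: dfs_numbering_def inj_on_def)
  moreover have "\<forall>x\<in>insert l V. ?pre x \<le> ?post x"
    using num by (auto simp: dfs_numbering_def)
  moreover have "ancestor ?pre ?post z y \<longleftrightarrow> z = y \<or> ancestor ?pre ?post z x"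
    if edge: "x \<in> insert l V" "y \<in> insert l V" "(x, y) \<in> E" "?pre x < ?pre y"
      and z: "z \<in> insert l V" for x y z
  proof -
    consider (old) "x \<in> V" "y \<in> V" | (to_leaf) "x = p" "y = l" | (from_leaf) "x = l" "y = p"
      using edge parent by (cases "x = l"; cases "y = l") auto
    then show ?thesis
    proof cases
      case old
      then have "pre x < pre y" using edge l_notin by (auto split: if_splits)
      then show ?thesis using old edge z num l_notin ancestor_old below_leaf
        by (cases "z = l") (auto simp: dfs_numbering_def)
    next
      case to_leaf
      then show ?thesis using z p_in l_notin above_leaf ancestor_old below_leaf
        by (cases "z = l") (auto simp: ancestor_def)
    next
      case from_leaf
      then show ?thesis using edge(4) \<open>p \<noteq> l\<close> by simp
    qed
  qed
  ultimately show ?thesis unfolding dfs_numbering_def by blast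
qed

lemma undirected_tree_dfs_numbering:
  assumes T: "undirected_tree T"
  obtains pre post where "dfs_numbering (parcs T) (pverts T) pre post"
proof -
  interpret T: pair_graph T using T by (simp add: undirected_tree_def)
  note sym = undirected_tree_sym[OF T]
  from T.pair_finite_verts sym undirected_tree_connected_in[OF T]
  have "\<exists>pre post. dfs_numbering (parcs T) (pverts T) pre post"
  proof (induction rule: connected_in_induct)
    case (singleton r)
    have "dfs_numbering (parcs T) {r} (\<lambda>_. 0) (\<lambda>_. 0)" by (simp add: dfs_numbering_def)
    then show ?case by blast
  next
    case (insert S p l)
    have "x = p" if "x \<in> S" "(x, l) \<in> parcs T \<or> (l, x) \<in> parcs T" for x
      using undirected_tree_unique_neighbour[OF T, of S l x p] insert that sym by (auto dest: symD)
    then show ?case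
      using insert dfs_numbering_insert_leaf[of "parcs T" S _ _ l p] by blast
  qed
  then show thesis using that by blast
qed

definition subtree_root ::
  "'b set \<Rightarrow> ('b \<Rightarrow> nat) \<Rightarrow> ('b \<Rightarrow> nat) \<Rightarrow> 'b set \<Rightarrow> 'b \<Rightarrow> bool" where
  "subtree_root V pre post S t \<longleftrightarrow>
     t \<in> S \<and> (\<forall>x\<in>S. ancestor pre post t x \<and>
       (\<forall>z\<in>V. pre t \<le> pre z \<and> ancestor pre post z x \<longrightarrow> z \<in> S))"

lemma dfs_numbering_subtree_root:
  assumes num: "dfs_numbering E V pre post" and "sym E" and S: "S \<subseteq> V" "connected_in E S"
  shows "\<exists>t. subtree_root V pre post S t"
proof -
  have edge: "ancestor pre post z y \<longleftrightarrow> z = y \<or> ancestor pre post z x"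
    if "(x, y) \<in> E" "pre x < pre y" "x \<in> V" "y \<in> V" "z \<in> V" for x y z
    using num that by (auto simp: dfs_numbering_def)
  obtain s where "s \<in> S" using S by (auto simp: connected_in_def)
  then obtain t where t: "t \<in> S" and first: "\<forall>y\<in>S. pre t \<le> pre y"
    using ex_has_least_nat[of "\<lambda>x. x \<in> S" s pre] by blast
  have "ancestor pre post t x \<and> (\<forall>z\<in>V. pre t \<le> pre z \<and> ancestor pre post z x \<longrightarrow> z \<in> S)"
    if "(t, x) \<in> rtrancl_on S E" for x
    using that
  proof (induction rule: rtrancl_on_induct)
    case base
    have "z = t" if "z \<in> V" "pre t \<le> pre z" "ancestor pre post z t" for z
      using that num S t by (auto simp: ancestor_def dfs_numbering_def dest: inj_onD)
    then show ?case using num S t by (auto simp: ancestor_def dfs_numbering_def)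
  next
    case (step x y)
    then have V: "x \<in> V" "y \<in> V" using S by auto
    have "(y, x) \<in> E" using step \<open>sym E\<close> by (auto dest: symD)
    consider (same) "x = y" | (down) "pre x < pre y" | (up) "pre y < pre x"
      using num V by (force simp: dfs_numbering_def dest: inj_onD)
    then show ?case
    proof cases
      case same
      then show ?thesis using step by simp
    next
      case down
      then show ?thesis using edge[OF \<open>(x, y) \<in> E\<close> down V] step S t by auto
    next
      case up
      then have "t \<noteq> x" using first \<open>y \<in> S\<close> by auto
      then show ?thesis using edge[OF \<open>(y, x) \<in> E\<close> up V(2,1)] step S t by auto
    qed
  qed
  then have "subtree_root V pre post S t"
    using S t unfolding subtree_root_def connected_in_def by blast
  then show ?thesis ..
qed

text \<open>Think of \<open>bag v\<close> as the bag at the topmost node of the subtree of \<open>v\<close>.\<close>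

definition ancestor_order ::
  "'a pair_pre_digraph \<Rightarrow> ('a \<Rightarrow> 'a set) \<Rightarrow> ('a \<Rightarrow> nat) \<Rightarrow> ('a \<Rightarrow> nat) \<Rightarrow> bool" where
  "ancestor_order G bag pre post \<longleftrightarrow>
     (\<forall>v\<in>pverts G. v \<in> bag v \<and> pre v \<le> post v) \<and>
     (\<forall>(u, v)\<in>parcs G. pre u \<le> pre v \<longrightarrow> ancestor pre post u v) \<and>
     (\<forall>(w, v)\<in>parcs G. \<forall>u\<in>pverts G. pre w \<le> pre u \<and> ancestor pre post u v \<longrightarrow> w \<in> bag u)"

lemma subtree_roots_ancestor_order:
  assumes G: "pair_graph G"
    and root: "\<And>v. v \<in> pverts G \<Longrightarrow> subtree_root N pre post {x \<in> N. v \<in> B x} (topmost v)"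
    and bags: "\<forall>(u, v)\<in>parcs G. \<exists>x\<in>N. u \<in> B x \<and> v \<in> B x"
  shows "ancestor_order G (B \<circ> topmost) (pre \<circ> topmost) (post \<circ> topmost)"
proof -
  interpret G: pair_graph G by fact
  have topmost: "topmost v \<in> N" "v \<in> B (topmost v)" if "v \<in> pverts G" for v
    using root[OF that] by (simp_all add: subtree_root_def)
  have topmost_ancestor: "ancestor pre post (topmost v) x"
    if "v \<in> pverts G" "x \<in> N" "v \<in> B x" for v x
    using root[OF that(1)] that by (simp add: subtree_root_def)
  have closed: "v \<in> B z"
    if "v \<in> pverts G" "x \<in> N" "v \<in> B x" "z \<in> N" "pre (topmost v) \<le> pre z" "ancestor pre post z x"
    for v x z
    using root[OF that(1)] that by (auto simp: subtree_root_def)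
  have in_later_bag: "w \<in> B (topmost v)"
    if wv: "(w, v) \<in> parcs G" and pre_le: "pre (topmost w) \<le> pre (topmost v)" for v w
  proof -
    have verts: "w \<in> pverts G" "v \<in> pverts G" using wv G.in_arcsD1 G.in_arcsD2 by auto
    obtain x where x: "x \<in> N" "w \<in> B x" "v \<in> B x" using bags wv by blast
    show ?thesis
      using closed[OF verts(1) x(1,2) _ pre_le] topmost_ancestor[OF verts(2) x(1,3)]
        topmost[OF verts(2)] by simp
  qed
  show ?thesis
    unfolding ancestor_order_def
  proof (intro conjI ballI; clarify?)
    show "v \<in> (B \<circ> topmost) v" "(pre \<circ> topmost) v \<le> (post \<circ> topmost) v" if "v \<in> pverts G" for v
      using topmost[OF that] topmost_ancestor[OF that topmost[OF that]]
      by (simp_all add: ancestor_def)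
    show "ancestor (pre \<circ> topmost) (post \<circ> topmost) u v"
      if uv: "(u, v) \<in> parcs G" and pre_le: "(pre \<circ> topmost) u \<le> (pre \<circ> topmost) v" for u v
      using topmost_ancestor[of u "topmost v"] in_later_bag[OF uv] topmost(1)[of v] pre_le
        G.in_arcsD1[OF uv] G.in_arcsD2[OF uv] by (simp add: ancestor_def)
    show "w \<in> (B \<circ> topmost) u"
      if wv: "(w, v) \<in> parcs G" and u: "u \<in> pverts G"
        and pre_le: "(pre \<circ> topmost) w \<le> (pre \<circ> topmost) u"
        and uv: "ancestor (pre \<circ> topmost) (post \<circ> topmost) u v" for u v w
      using closed[of w "topmost v" "topmost u"] in_later_bag[OF wv]
        topmost(1)[OF u] topmost(1)[of v] pre_le uv G.in_arcsD1[OF wv] G.in_arcsD2[OF wv]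
      by (simp add: ancestor_def)
  qed
qed

lemma tree_decomposition_ancestor_order:
  assumes G: "pair_graph G" and TD: "tree_decomposition G T B"
  obtains topmost pre post
  where "topmost ` pverts G \<subseteq> pverts T" "ancestor_order G (B \<circ> topmost) pre post"
proof -
  have T: "undirected_tree T" using TD by (simp add: tree_decomposition_def)
  note sym = undirected_tree_sym[OF T]
  obtain pre post where num: "dfs_numbering (parcs T) (pverts T) pre post"
    by (rule undirected_tree_dfs_numbering[OF T])
  let ?S = "\<lambda>v. {x \<in> pverts T. v \<in> B x}"
  have "connected_in (parcs T) (?S v)" if "v \<in> pverts G" for v
    using TD that connected_induce_subgraph_iff[OF sym] by (simp add: tree_decomposition_def)
  then have "\<forall>v\<in>pverts G. \<exists>t. subtree_root (pverts T) pre post (?S v) t"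
    by (intro ballI dfs_numbering_subtree_root[OF num sym]) auto
  then obtain topmost where
    topmost: "\<forall>v\<in>pverts G. subtree_root (pverts T) pre post (?S v) (topmost v)"
    by (elim bchoice[THEN exE])
  then have "topmost ` pverts G \<subseteq> pverts T" by (auto simp: subtree_root_def)
  moreover have "ancestor_order G (B \<circ> topmost) (pre \<circ> topmost) (post \<circ> topmost)"
    using topmost TD
    by (intro subtree_roots_ancestor_order[OF G, where N = "pverts T"])
      (simp_all add: tree_decomposition_def)
  ultimately show thesis by (rule that)
qed

section \<open>Layers and colours\<close>

lemma layering_function:
  assumes "layering G n L"
  obtains lay :: "'a \<Rightarrow> nat"
  where "\<And>v. v \<in> pverts G \<Longrightarrow> lay v \<in> {1..n}"
    and "\<And>i. i \<in> {1..n} \<Longrightarrow> L i = {v \<in> pverts G. lay v = i}"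
    and "\<And>u v. (u, v) \<in> parcs G \<Longrightarrow> lay u \<le> lay v + 1 \<and> lay v \<le> lay u + 1"
proof -
  have union: "(\<Union>i\<in>{1..n}. L i) = pverts G" and disjoint: "disjoint_family_on L {1..n}"
    and edges: "\<forall>(v, w)\<in>parcs G. \<exists>i\<in>{1..n - 1}. v \<in> L i \<union> L (i + 1) \<and> w \<in> L i \<union> L (i + 1)"
    using assms unfolding layering_def by simp_all
  define lay where "lay v = (THE i. i \<in> {1..n} \<and> v \<in> L i)" for v
  have lay: "lay v = i" if "i \<in> {1..n}" "v \<in> L i" for v i
    using that disjoint unfolding lay_def disjoint_family_on_def by (intro the_equality) blast+
  show thesis
  proof (rule that[of lay])
    show "lay v \<in> {1..n}" if "v \<in> pverts G" for v
      using that lay unfolding union[symmetric] by blast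
    show "L i = {v \<in> pverts G. lay v = i}" if "i \<in> {1..n}" for i
      using that lay unfolding union[symmetric] by blast
    show "lay u \<le> lay v + 1 \<and> lay v \<le> lay u + 1" if uv: "(u, v) \<in> parcs G" for u v
    proof -
      obtain i where "i \<in> {1..n - 1}" "u \<in> L i \<union> L (i + 1)" "v \<in> L i \<union> L (i + 1)"
        using edges uv by blast
      then have "lay u \<in> {i, i + 1}" "lay v \<in> {i, i + 1}"
        using lay[of i] lay[of "i + 1"] by fastforce+
      then show ?thesis by auto
    qed
  qed
qed

lemma injective_refinement:
  fixes f :: "'a \<Rightarrow> nat"
  assumes "finite V"
  obtains g :: "'a \<Rightarrow> nat" where "inj_on g V"
    and "\<And>u v. \<lbrakk>u \<in> V; v \<in> V; g u \<le> g v\<rbrakk> \<Longrightarrow> f u \<le> f v"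
proof -
  obtain idx :: "'a \<Rightarrow> nat" and N where idx: "idx ` V = {i. i < N}" "inj_on idx V"
    using finite_imp_inj_to_nat_seg[OF assms] by blast
  define g where "g v = N * f v + idx v" for v
  have "g v div N = f v" "g v mod N = idx v" if "v \<in> V" for v
  proof -
    have "idx v < N" using idx(1) that by auto
    then show "g v div N = f v" "g v mod N = idx v" by (simp_all add: g_def)
  qed
  then show thesis
    using that[of g] idx(2) by (metis div_le_mono inj_on_def)
qed

lemma greedy_colouring:
  fixes ord :: "'a \<Rightarrow> 'b :: linorder"
  assumes "finite V" and "\<And>v. v \<in> V \<Longrightarrow> card {u \<in> V. ord u < ord v \<and> R u v} < k"
  obtains col :: "'a \<Rightarrow> nat" where "\<And>v. v \<in> V \<Longrightarrow> col v < k"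
    and "\<And>u v. \<lbrakk>u \<in> V; v \<in> V; ord u < ord v; R u v\<rbrakk> \<Longrightarrow> col u \<noteq> col v"
proof -
  define proper where "proper S col \<longleftrightarrow> (\<forall>v\<in>S. col v < k) \<and>
    (\<forall>u\<in>S. \<forall>v\<in>S. ord u < ord v \<and> R u v \<longrightarrow> col u \<noteq> col v)" for S and col :: "'a \<Rightarrow> nat"
  from assms have "\<exists>col. proper V col"
  proof (induction V rule: finite_ranking_induct[where f = ord])
    case empty
    then show ?case by (simp add: proper_def)
  next
    case (insert x S)
    let ?A = "\<lambda>V v. {u \<in> V. ord u < ord v \<and> R u v}"
    have mono: "card (?A S v) \<le> card (?A (insert x S) v)" for v
      using insert.hyps(1) by (intro card_mono) auto
    have "card (?A S v) < k" if "v \<in> S" for v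
      using mono insert.prems that by (meson insertI2 le_less_trans)
    then obtain col where col: "proper S col" using insert.IH by blast
    have "card (col ` ?A S x) \<le> card (?A S x)" by (rule card_image_le) (simp add: insert.hyps(1))
    also have "\<dots> < card {..<k}" using mono[of x] insert.prems[of x] by simp
    finally have "\<not> {..<k} \<subseteq> col ` ?A S x"
      using insert.hyps(1) card_mono[of "col ` ?A S x" "{..<k}"] by force
    then obtain c where "c < k" "c \<notin> col ` ?A S x" by auto
    then have "proper (insert x S) (col(x := c))"
      using col insert.hyps(2) by (fastforce simp: proper_def)
    then show ?case by blast
  qed
  then show thesis using that by (auto simp: proper_def)
qed

text \<open>Tagging the colours by the layer index modulo 3 separates layers at distance 1 and 2.\<close>

lemma layered_greedy_colouring:
  fixes ord :: "'a \<Rightarrow> 'b :: linorder" and lay :: "'a \<Rightarrow> nat"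
  assumes "finite V"
    and bag: "\<And>v. v \<in> V \<Longrightarrow> v \<in> bag v \<and> finite (bag v) \<and> card {u \<in> bag v. lay u = lay v} \<le> k"
  obtains C :: "'a \<Rightarrow> nat" where "\<And>v. v \<in> V \<Longrightarrow> C v < 3 * k"
    and "\<And>u v. \<lbrakk>u \<in> V; v \<in> V; ord u < ord v; u \<in> bag v; lay u \<le> lay v + 2; lay v \<le> lay u + 2\<rbrakk>
           \<Longrightarrow> C u \<noteq> C v"
proof -
  have "card {u \<in> V. ord u < ord v \<and> u \<in> bag v \<and> lay u = lay v} < k" if "v \<in> V" for v
  proof -
    have "{u \<in> V. ord u < ord v \<and> u \<in> bag v \<and> lay u = lay v} \<subset> {u \<in> bag v. lay u = lay v}"
      (is "?earlier \<subset> ?layer")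
      using bag[OF that] by blast
    then have "card ?earlier < card ?layer" using bag[OF that] by (intro psubset_card_mono) auto
    then show ?thesis using bag[OF that] by simp
  qed
  then obtain col where col: "\<And>v. v \<in> V \<Longrightarrow> col v < k"
    "\<And>u v. \<lbrakk>u \<in> V; v \<in> V; ord u < ord v; u \<in> bag v \<and> lay u = lay v\<rbrakk> \<Longrightarrow> col u \<noteq> col v"
    using greedy_colouring[of V ord "\<lambda>u v. u \<in> bag v \<and> lay u = lay v" k] assms(1) by blast
  define C where "C v = 3 * col v + lay v mod 3" for v
  have C: "C v div 3 = col v" "C v mod 3 = lay v mod 3" for v by (simp_all add: C_def)
  show thesis
  proof (rule that[of C])
    show "C v < 3 * k" if "v \<in> V" for v using col(1)[OF that] by (simp add: C_def)
    show "C u \<noteq> C v"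
      if uv: "u \<in> V" "v \<in> V" "ord u < ord v" "u \<in> bag v"
        and close: "lay u \<le> lay v + 2" "lay v \<le> lay u + 2" for u v
    proof
      assume "C u = C v"
      then have "col u = col v" "lay u mod 3 = lay v mod 3" using C by metis+
      then have "lay u = lay v" using close by presburger
      then show False using col(2)[of u v] uv \<open>col u = col v\<close> by blast
    qed
  qed
qed

section \<open>Interval representations\<close>

definition interval_representation ::
  "'a pair_pre_digraph \<Rightarrow> nat \<Rightarrow> ('a \<Rightarrow> nat \<Rightarrow> real set) \<Rightarrow> bool" where
  "interval_representation G d I \<longleftrightarrow>
     (\<forall>v\<in>pverts G. \<forall>i<d. is_interval (I v i) \<and> I v i \<noteq> {}) \<and>
     (\<forall>u\<in>pverts G. \<forall>v\<in>pverts G. u \<noteq> v \<longrightarrow>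
        ((\<forall>i<d. I u i \<inter> I v i \<noteq> {}) \<longleftrightarrow> (u, v) \<in> parcs G))"

lemma interval_representation_imp_box_representation:
  assumes "interval_representation G d I"
  shows "box_representation G d (\<lambda>v. \<Pi>\<^sub>E i\<in>{..<d}. I v i)"
proof -
  have "(\<Pi>\<^sub>E i\<in>{..<d}. I u i) \<inter> (\<Pi>\<^sub>E i\<in>{..<d}. I v i) \<noteq> {} \<longleftrightarrow>
    (\<forall>i<d. I u i \<inter> I v i \<noteq> {})" for u v
    by (auto simp: PiE_Int PiE_eq_empty_iff)
  moreover have "is_box d (\<Pi>\<^sub>E i\<in>{..<d}. I v i)" if "v \<in> pverts G" for v
    using assms that unfolding interval_representation_def is_box_def
    by (intro exI[of _ "I v"]) simp
  ultimately show ?thesis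
    using assms by (simp add: interval_representation_def box_representation_def)
qed

lemma all_less_add_iff: "(\<forall>i<d + m. P i) \<longleftrightarrow> (\<forall>i<d. P i) \<and> (\<forall>c<m. P (d + c))" for d m :: nat
proof -
  have "P i" if "\<forall>i<d. P i" "\<forall>c<m. P (d + c)" "i < d + m" for i
    using that by (cases "i < d") (auto simp: not_less le_iff_add)
  then show ?thesis by auto
qed

lemma interval_representation_extend:
  assumes rep_H: "interval_representation H d I" and verts: "pverts H = pverts G"
    and intervals: "\<And>v c. \<lbrakk>v \<in> pverts G; c < m\<rbrakk> \<Longrightarrow> is_interval (J v c) \<and> J v c \<noteq> {}"
    and edges: "\<And>u v. \<lbrakk>u \<in> pverts G; v \<in> pverts G; u \<noteq> v\<rbrakk> \<Longrightarrow>
      (u, v) \<in> parcs G \<longleftrightarrow> (u, v) \<in> parcs H \<and> (\<forall>c<m. J u c \<inter> J v c \<noteq> {})"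
  shows "interval_representation G (d + m) (\<lambda>v i. if i < d then I v i else J v (i - d))"
    (is "interval_representation G _ ?K")
proof -
  have "(\<forall>i<d + m. ?K u i \<inter> ?K v i \<noteq> {}) \<longleftrightarrow> (u, v) \<in> parcs G"
    if uv: "u \<in> pverts G" "v \<in> pverts G" "u \<noteq> v" for u v
  proof -
    have "(\<forall>i<d + m. ?K u i \<inter> ?K v i \<noteq> {}) \<longleftrightarrow>
        (\<forall>i<d. I u i \<inter> I v i \<noteq> {}) \<and> (\<forall>c<m. J u c \<inter> J v c \<noteq> {})"
      by (simp add: all_less_add_iff)
    also have "\<dots> \<longleftrightarrow> (u, v) \<in> parcs G"
      using rep_H uv verts edges[OF uv] by (simp add: interval_representation_def)
    finally show ?thesis .
  qed
  moreover have "is_interval (?K v i) \<and> ?K v i \<noteq> {}" if "v \<in> pverts G" "i < d + m" for v i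
    using that rep_H verts intervals by (auto simp: interval_representation_def)
  ultimately show ?thesis by (simp add: interval_representation_def)
qed

text \<open>
  The dimension of colour \<open>c\<close> shows a vertex of colour \<open>c\<close> as a point and any other vertex as the
  half-line that just reaches all its neighbours of colour \<open>c\<close>. It separates a point from the
  later half-lines all of whose neighbours of colour \<open>c\<close> lie beyond it.
\<close>

definition colour_interval ::
  "'a rel \<Rightarrow> ('a \<Rightarrow> nat) \<Rightarrow> ('a \<Rightarrow> real) \<Rightarrow> 'a \<Rightarrow> nat \<Rightarrow> real set" where
  "colour_interval E C pos v c =
     (if C v = c then {pos v} else {Min (pos ` insert v {w. (w, v) \<in> E \<and> C w = c})..})"

lemma is_interval_colour_interval: "is_interval (colour_interval E C pos v c)"
  and colour_interval_nonempty: "colour_interval E C pos v c \<noteq> {}"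
  by (auto simp: colour_interval_def is_interval_1)

lemma finite_coloured_neighbours: "finite E \<Longrightarrow> finite {w. (w, v) \<in> E \<and> C w = c}"
  by (rule finite_subset[of _ "fst ` E"]) force+

lemma colour_interval_Int_nonempty:
  assumes "finite E" "sym E" and uv: "(u, v) \<in> E" "C u \<noteq> C v"
  shows "colour_interval E C pos u c \<inter> colour_interval E C pos v c \<noteq> {}"
proof -
  have point: "pos x \<in> colour_interval E C pos y (C x)" if "(x, y) \<in> E" "C x \<noteq> C y" for x y
    using that finite_coloured_neighbours[OF assms(1), of y C "C x"]
    by (auto simp: colour_interval_def intro!: Min_le)
  have vu: "(v, u) \<in> E" using assms by (auto dest: symD)
  consider (point_u) "C u = c" | (point_v) "C v = c" | (half_lines) "C u \<noteq> c" "C v \<noteq> c" by blast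
  then show ?thesis
  proof cases
    case point_u
    then show ?thesis using point[OF uv] by (auto simp: colour_interval_def)
  next
    case point_v
    then show ?thesis using point[OF vu] uv by (auto simp: colour_interval_def)
  next
    case half_lines
    moreover have "{a..} \<inter> {b..} \<noteq> {}" for a b :: real
      using max.cobounded1[of a b] max.cobounded2[of b a] by blast
    ultimately show ?thesis by (simp add: colour_interval_def)
  qed
qed

lemma colour_interval_Int_empty:
  assumes "finite E" "pos u < pos v" and "\<And>w. \<lbrakk>(w, v) \<in> E; C w = C u\<rbrakk> \<Longrightarrow> pos u < pos w"
  shows "colour_interval E C pos u (C u) \<inter> colour_interval E C pos v (C u) = {}"
proof -
  have "pos u < Min (pos ` insert v {w. (w, v) \<in> E \<and> C w = C u})"
    using assms finite_coloured_neighbours[OF assms(1), of v C "C u"] by simp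
  then show ?thesis using assms(2) by (simp add: colour_interval_def)
qed

lemma interval_representation_add_colours:
  assumes G: "pair_graph G" and rep_H: "interval_representation H d I"
    and super: "pverts H = pverts G" "parcs G \<subseteq> parcs H" and "sym (parcs H)"
    and inj: "inj_on pos (pverts G)" and colours: "\<And>v. v \<in> pverts G \<Longrightarrow> C v < m"
    and proper: "\<And>u v. (u, v) \<in> parcs G \<Longrightarrow> C u \<noteq> C v"
    and separated: "\<And>u v w. \<lbrakk>(w, v) \<in> parcs G; (u, v) \<in> parcs H; pos w < pos u; pos u < pos v\<rbrakk>
      \<Longrightarrow> C w \<noteq> C u"
  shows "interval_representation G (d + m)
    (\<lambda>v i. if i < d then I v i else colour_interval (parcs G) C pos v (i - d))"
proof (rule interval_representation_extend[OF rep_H super(1)])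
  interpret G: pair_graph G by fact
  let ?J = "colour_interval (parcs G) C pos"
  have sym: "sym (parcs G)" using G.pair_sym_arcs by (simp add: symmetric_def)
  show "is_interval (?J v c) \<and> ?J v c \<noteq> {}" for v c
    by (simp add: is_interval_colour_interval colour_interval_nonempty)
  have disjoint: "\<exists>c<m. ?J u c \<inter> ?J v c = {}"
    if verts: "u \<in> pverts G" "v \<in> pverts G" and less: "pos u < pos v"
      and uv: "(u, v) \<in> parcs H" "(u, v) \<notin> parcs G" for u v
  proof -
    have "pos u < pos w" if w: "(w, v) \<in> parcs G" "C w = C u" for w
    proof -
      have "w \<in> pverts G" "w \<noteq> u" using w uv G.in_arcsD1 by auto
      then have "pos w \<noteq> pos u" using inj verts by (auto dest: inj_onD)
      then show ?thesis using separated[OF w(1) uv(1) _ less] w(2) by force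
    qed
    then have "?J u (C u) \<inter> ?J v (C u) = {}"
      using colour_interval_Int_empty[OF G.pair_finite_arcs] less by simp
    then show ?thesis using colours[OF verts(1)] by blast
  qed
  show "(u, v) \<in> parcs G \<longleftrightarrow> (u, v) \<in> parcs H \<and> (\<forall>c<m. ?J u c \<inter> ?J v c \<noteq> {})"
    if verts: "u \<in> pverts G" "v \<in> pverts G" "u \<noteq> v" for u v
  proof
    assume uv: "(u, v) \<in> parcs G"
    then show "(u, v) \<in> parcs H \<and> (\<forall>c<m. ?J u c \<inter> ?J v c \<noteq> {})"
      using super(2) colour_interval_Int_nonempty[OF G.pair_finite_arcs sym uv] proper by blast
  next
    assume meets: "(u, v) \<in> parcs H \<and> (\<forall>c<m. ?J u c \<inter> ?J v c \<noteq> {})"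
    then have "(v, u) \<in> parcs H" using \<open>sym (parcs H)\<close> by (auto dest: symD)
    moreover have "pos u < pos v \<or> pos v < pos u" using inj verts by (metis inj_onD linorder_neqE)
    ultimately show "(u, v) \<in> parcs G"
      using disjoint[OF verts(1,2)] disjoint[OF verts(2,1)] meets sym by (metis Int_commute symD)
  qed
qed

definition ancestor_layer_graph ::
  "'a set \<Rightarrow> ('a \<Rightarrow> nat) \<Rightarrow> ('a \<Rightarrow> nat) \<Rightarrow> ('a \<Rightarrow> nat) \<Rightarrow> 'a pair_pre_digraph" where
  "ancestor_layer_graph V pre post lay =
     \<lparr>pverts = V,
      parcs = {(u, v). u \<in> V \<and> v \<in> V \<and> u \<noteq> v \<and> (ancestor pre post u v \<or> ancestor pre post v u) \<and>
        lay u \<le> lay v + 1 \<and> lay v \<le> lay u + 1}\<rparr>"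

lemma ancestor_layer_graph_interval_representation:
  assumes "\<And>v. v \<in> V \<Longrightarrow> pre v \<le> post v"
  shows "interval_representation (ancestor_layer_graph V pre post lay) 2
    (\<lambda>v i. if i = 0 then {real (pre v)..real (post v)} else {real (lay v)..real (lay v) + 1})"
    (is "interval_representation ?H 2 ?I")
proof -
  have "(\<forall>i<2. ?I u i \<inter> ?I v i \<noteq> {}) \<longleftrightarrow> (u, v) \<in> parcs ?H"
    if "u \<in> V" "v \<in> V" "u \<noteq> v" for u v
  proof -
    have "(\<forall>i<2. ?I u i \<inter> ?I v i \<noteq> {}) \<longleftrightarrow> ?I u 0 \<inter> ?I v 0 \<noteq> {} \<and> ?I u 1 \<inter> ?I v 1 \<noteq> {}"
      by (auto simp: less_2_cases_iff)
    also have "?I u 0 \<inter> ?I v 0 \<noteq> {} \<longleftrightarrow> ancestor pre post u v \<or> ancestor pre post v u"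
      using assms[OF that(1)] assms[OF that(2)] by (auto simp: ancestor_def)
    also have "?I u 1 \<inter> ?I v 1 \<noteq> {} \<longleftrightarrow> lay u \<le> lay v + 1 \<and> lay v \<le> lay u + 1"
      by auto
    finally show ?thesis using that by (simp add: ancestor_layer_graph_def)
  qed
  moreover have "is_interval (?I v i) \<and> ?I v i \<noteq> {}" if "v \<in> V" for v i
    using assms[OF that] by simp
  ultimately show ?thesis
    by (simp add: interval_representation_def ancestor_layer_graph_def)
qed

section \<open>Boxicity and layered treewidth\<close>

lemma ancestor_order_subgraph:
  assumes G: "pair_graph G" and order: "ancestor_order G bag pre post"
    and edge_lay: "\<And>u v. (u, v) \<in> parcs G \<Longrightarrow> lay u \<le> lay v + 1 \<and> lay v \<le> lay u + 1"
  shows "parcs G \<subseteq> parcs (ancestor_layer_graph (pverts G) pre post lay)"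
proof clarify
  interpret G: pair_graph G by fact
  fix u v assume edge: "(u, v) \<in> parcs G"
  then have "(v, u) \<in> parcs G" using G.pair_sym_arcs by (auto simp: symmetric_def dest: symD)
  then have "ancestor pre post u v \<or> ancestor pre post v u"
    using order edge linear[of "pre u" "pre v"] by (auto simp: ancestor_order_def)
  then show "(u, v) \<in> parcs (ancestor_layer_graph (pverts G) pre post lay)"
    using G.in_arcsD1[OF edge] G.in_arcsD2[OF edge] G.pair_no_loops[OF edge] edge_lay[OF edge]
    by (simp add: ancestor_layer_graph_def)
qed

lemma ancestor_order_in_bag:
  assumes order: "ancestor_order G bag pre post"
    and "(w, v) \<in> parcs G" "u \<in> pverts G" "pre w \<le> pre u" "pre u \<le> pre v"
    and "u = v \<or> ancestor pre post u v \<or> ancestor pre post v u"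
  shows "w \<in> bag u"
proof -
  have "pre u \<le> post u" using assms by (simp add: ancestor_order_def)
  then have "ancestor pre post u v" using assms(5,6) by (auto simp: ancestor_def)
  then show ?thesis using assms(1-4) by (fastforce simp: ancestor_order_def)
qed

lemma ancestor_order_colouring:
  fixes G :: "'a pair_pre_digraph" and ord lay :: "'a \<Rightarrow> nat"
  assumes G: "pair_graph G" and order: "ancestor_order G bag pre post"
    and bag: "\<And>v. v \<in> pverts G \<Longrightarrow> finite (bag v) \<and> card {u \<in> bag v. lay u = lay v} \<le> k"
    and edge_lay: "\<And>u v. (u, v) \<in> parcs G \<Longrightarrow> lay u \<le> lay v + 1 \<and> lay v \<le> lay u + 1"
    and pre_mono: "\<And>u v. \<lbrakk>u \<in> pverts G; v \<in> pverts G; ord u \<le> ord v\<rbrakk> \<Longrightarrow> pre u \<le> pre v"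
  obtains C :: "'a \<Rightarrow> nat" where "\<And>v. v \<in> pverts G \<Longrightarrow> C v < 3 * k"
    and "\<And>u v w. \<lbrakk>(w, v) \<in> parcs G;
      u = v \<or> (u, v) \<in> parcs (ancestor_layer_graph (pverts G) pre post lay);
      ord w < ord u; ord u \<le> ord v\<rbrakk> \<Longrightarrow> C w \<noteq> C u"
proof -
  interpret G: pair_graph G by fact
  let ?V = "pverts G"
  have "v \<in> bag v \<and> finite (bag v) \<and> card {u \<in> bag v. lay u = lay v} \<le> k" if "v \<in> ?V" for v
    using order bag[OF that] that by (simp add: ancestor_order_def)
  then obtain C where C_less: "\<And>v. v \<in> ?V \<Longrightarrow> C v < 3 * k"
    and C_neq: "\<And>u v. \<lbrakk>u \<in> ?V; v \<in> ?V; ord u < ord v; u \<in> bag v;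
      lay u \<le> lay v + 2; lay v \<le> lay u + 2\<rbrakk> \<Longrightarrow> C u \<noteq> C v"
    using layered_greedy_colouring[OF G.pair_finite_verts, of bag lay k ord] by blast
  have "C w \<noteq> C u"
    if edge: "(w, v) \<in> parcs G"
      and uv: "u = v \<or> (u, v) \<in> parcs (ancestor_layer_graph ?V pre post lay)"
      and less: "ord w < ord u" "ord u \<le> ord v" for u v w
  proof -
    have verts: "w \<in> ?V" "v \<in> ?V" using G.in_arcsD1[OF edge] G.in_arcsD2[OF edge] .
    then have u_in_layers: "u \<in> ?V" "lay u \<le> lay v + 1" "lay v \<le> lay u + 1"
      using uv by (auto simp: ancestor_layer_graph_def)
    have "w \<in> bag u"
      using uv less pre_mono[OF verts(1) u_in_layers(1)] pre_mono[OF u_in_layers(1) verts(2)]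
      by (intro ancestor_order_in_bag[OF order edge u_in_layers(1)])
        (auto simp: ancestor_layer_graph_def)
    then show ?thesis
      using C_neq[OF verts(1) u_in_layers(1)] less edge_lay[OF edge] u_in_layers by simp
  qed
  with C_less show thesis by (rule that)
qed

lemma ancestor_order_interval_representation:
  fixes G :: "'a pair_pre_digraph" and lay :: "'a \<Rightarrow> nat"
  assumes G: "pair_graph G" and order: "ancestor_order G bag pre post"
    and bag: "\<And>v. v \<in> pverts G \<Longrightarrow> finite (bag v) \<and> card {u \<in> bag v. lay u = lay v} \<le> k"
    and edge_lay: "\<And>u v. (u, v) \<in> parcs G \<Longrightarrow> lay u \<le> lay v + 1 \<and> lay v \<le> lay u + 1"
  shows "\<exists>I. interval_representation G (2 + 3 * k) I"
proof -
  interpret G: pair_graph G by fact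
  let ?V = "pverts G" and ?H = "ancestor_layer_graph (pverts G) pre post lay"
  obtain ord :: "'a \<Rightarrow> nat" where inj: "inj_on ord ?V"
    and pre_mono: "\<And>u v. \<lbrakk>u \<in> ?V; v \<in> ?V; ord u \<le> ord v\<rbrakk> \<Longrightarrow> pre u \<le> pre v"
    using injective_refinement[OF G.pair_finite_verts] by blast
  obtain C where C_less: "\<And>v. v \<in> ?V \<Longrightarrow> C v < 3 * k"
    and separated: "\<And>u v w. \<lbrakk>(w, v) \<in> parcs G; u = v \<or> (u, v) \<in> parcs ?H;
      ord w < ord u; ord u \<le> ord v\<rbrakk> \<Longrightarrow> C w \<noteq> C u"
    using ancestor_order_colouring[OF G order bag edge_lay pre_mono] by blast
  have proper: "C u \<noteq> C v" if edge: "(u, v) \<in> parcs G" for u v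
  proof -
    have "ord u \<noteq> ord v"
      using inj G.in_arcsD1[OF edge] G.in_arcsD2[OF edge] G.pair_no_loops[OF edge]
      by (auto dest: inj_onD)
    moreover have "(v, u) \<in> parcs G"
      using edge G.pair_sym_arcs by (auto simp: symmetric_def dest: symD)
    ultimately show ?thesis using separated[of u v v] separated[of v u u] edge by force
  qed
  have "pre v \<le> post v" if "v \<in> ?V" for v using order that by (simp add: ancestor_order_def)
  note rep_H = ancestor_layer_graph_interval_representation[OF this]
  have verts: "pverts ?H = ?V" and sym: "sym (parcs ?H)"
    by (auto simp: ancestor_layer_graph_def intro!: symI)
  have inj_pos: "inj_on (\<lambda>v. real (ord v)) ?V" using inj by (simp add: inj_on_def)
  show ?thesis
    using rep_H verts ancestor_order_subgraph[OF G order edge_lay] sym inj_pos C_less proper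
    by (intro exI, rule interval_representation_add_colours[OF G]) (use separated in auto)
qed

lemma layered_width_imp_interval_representation:
  fixes G :: "'a pair_pre_digraph"
  assumes G: "pair_graph G" and "layered_width_at_most G k"
  shows "\<exists>I. interval_representation G (2 + 3 * k) I"
proof -
  interpret G: pair_graph G by fact
  obtain T :: "nat pair_pre_digraph" and B n L where TD: "tree_decomposition G T B"
    and L: "layering G n L" and width: "\<forall>x\<in>pverts T. \<forall>i\<in>{1..n}. card (B x \<inter> L i) \<le> k"
    using assms(2) unfolding layered_width_at_most_def by blast
  obtain topmost pre post where topmost: "topmost ` pverts G \<subseteq> pverts T"
    and order: "ancestor_order G (B \<circ> topmost) pre post"
    by (rule tree_decomposition_ancestor_order[OF G TD])
  obtain lay where lay: "\<And>v. v \<in> pverts G \<Longrightarrow> lay v \<in> {1..n}"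
      "\<And>i. i \<in> {1..n} \<Longrightarrow> L i = {v \<in> pverts G. lay v = i}"
    and edge_lay: "\<And>u v. (u, v) \<in> parcs G \<Longrightarrow> lay u \<le> lay v + 1 \<and> lay v \<le> lay u + 1"
    using layering_function[OF L] by blast
  have "finite ((B \<circ> topmost) v) \<and> card {u \<in> (B \<circ> topmost) v. lay u = lay v} \<le> k"
    if v: "v \<in> pverts G" for v
  proof -
    have "topmost v \<in> pverts T" using topmost v by auto
    moreover from this have "B (topmost v) \<subseteq> pverts G"
      using TD by (simp add: tree_decomposition_def)
    moreover from this have "{u \<in> B (topmost v). lay u = lay v} = B (topmost v) \<inter> L (lay v)"
      using lay v by auto
    ultimately show ?thesis
      using lay(1)[OF v] width finite_subset[OF _ G.pair_finite_verts] by simp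
  qed
  then show ?thesis
    by (rule ancestor_order_interval_representation[OF G order _ edge_lay])
qed

theorem theorem5p2:
  fixes G :: "'a pair_pre_digraph"
  assumes "pair_graph G"
  shows "boxicity G \<le> 6 * layered_treewidth G + 4"
proof (cases "\<exists>k. layered_width_at_most G k")
  case True
  then have "layered_treewidth G \<in> enat ` {k. layered_width_at_most G k}"
    unfolding layered_treewidth_def by (auto intro: wellorder_InfI)
  then obtain k where k: "layered_width_at_most G k" "layered_treewidth G = enat k" by auto
  then obtain I where "interval_representation G (2 + 3 * k) I"
    using layered_width_imp_interval_representation[OF assms] by blast
  then have "boxicity G \<le> enat (2 + 3 * k)"
    unfolding boxicity_def
    by (intro INF_lower) (auto dest: interval_representation_imp_box_representation)
  also have "\<dots> \<le> 6 * layered_treewidth G + 4"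
    by (simp add: k(2) numeral_eq_enat)
  finally show ?thesis .
next
  case False
  then have "layered_treewidth G = \<infinity>" by (simp add: layered_treewidth_def top_enat_def)
  then show ?thesis by (simp add: numeral_eq_enat)
qed

end
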